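(* Let $n\ge 2$. For a strict complete preference profile $S$ of size $n$, let $\mathbb{E}_{\mathrm{Unif}}[B_S]$ be the expected number of blocking pairs of a complete matching chosen uniformly at random among all $n!$ matchings. Then the minimum of $\mathbb{E}_{\mathrm{Unif}}[B_S]$ over all strict complete preference profiles $S$ of size $n$ is attained at the cyclic Hollow-Shell $C_n$, where $$\mathbb{E}_{\mathrm{Unif}}[B_{C_n}]=\frac{n(n-2)}{6}.$$ In particular, as $n\to\infty$, this minimum is asymptotic to $n^2/6$, whereas $\lfloor (n-1)^2/4\rfloor$ is asymptotic to $n^2/4$.
   Context: An instance (profile) $S$ of size $n$ consists of $n$ men $m_0,\dots,m_{n-1}$ and $n$ women $w_0,\dots,w_{n-1}$, each with a strict complete preference order on the other side. A complete matching is a bijection $\mu$ from men to women. $(m_i,w_j)$ blocks $\mu$ if $m_i$ strictly prefers $w_j$ to $\mu(m_i)$ and $w_j$ strictly prefers $m_i$ to $\mu^{-1}(w_j)$; $B_S(\mu)$ is the number of blocking pairs. $r_M(g,h)$ is the rank (1 is best) of woman $h$ in man $g$'s list and $r_W(h,g)$ the rank of man $g$ in woman $h$'s list. The cyclic Hollow-Shell $C_n$ is the instance with $r_M(g,h)=((h-g)\bmod n)+1$ and $r_W(h,g)=n-((h-g)\bmod n)$, where $\bmod\ n$ takes values in $\{0,\dots,n-1\}$. *)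

theory Defs
  imports "HOL-Probability.Probability" "HOL-Combinatorics.Permutations"
    "HOL-Library.Landau_Symbols"
begin

text \<open>
  Men and women are both indexed by \<open>{..<n}\<close>. The pair \<open>(h, h')\<close> belongs to \<open>man_pref S g\<close>
  iff man \<open>g\<close> strictly prefers woman \<open>h\<close> to woman \<open>h'\<close>; dually for \<open>woman_pref\<close>.
  Preferences of agents with index \<open>\<ge> n\<close> are irrelevant and unconstrained.
\<close>

record profile =
  man_pref :: "nat \<Rightarrow> nat rel"
  woman_pref :: "nat \<Rightarrow> nat rel"

definition strict_pref_order :: "nat \<Rightarrow> nat rel \<Rightarrow> bool" where
  "strict_pref_order n r \<longleftrightarrow> r \<subseteq> {..<n} \<times> {..<n} \<and> strict_linear_order_on {..<n} r"

definition profiles :: "nat \<Rightarrow> profile set" where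
  "profiles n = {S. \<forall>i<n. strict_pref_order n (man_pref S i) \<and> strict_pref_order n (woman_pref S i)}"

definition man_rank :: "nat \<Rightarrow> profile \<Rightarrow> nat \<Rightarrow> nat \<Rightarrow> nat" where
  "man_rank n S g h = card {h'. h' < n \<and> (h', h) \<in> man_pref S g} + 1"

definition woman_rank :: "nat \<Rightarrow> profile \<Rightarrow> nat \<Rightarrow> nat \<Rightarrow> nat" where
  "woman_rank n S h g = card {g'. g' < n \<and> (g', g) \<in> woman_pref S h} + 1"

text \<open>
  Using permutations of \<open>{..<n}\<close> (which are the identity elsewhere) makes each bijection from men
  to women be counted exactly once, and makes \<open>inv \<mu>\<close> its inverse.
\<close>

definition matchings :: "nat \<Rightarrow> (nat \<Rightarrow> nat) set" where
  "matchings n = {\<mu>. \<mu> permutes {..<n}}"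

definition blocks :: "profile \<Rightarrow> (nat \<Rightarrow> nat) \<Rightarrow> nat \<Rightarrow> nat \<Rightarrow> bool" where
  "blocks S \<mu> i j \<longleftrightarrow> (j, \<mu> i) \<in> man_pref S i \<and> (i, inv \<mu> j) \<in> woman_pref S j"

definition num_blocking :: "nat \<Rightarrow> profile \<Rightarrow> (nat \<Rightarrow> nat) \<Rightarrow> nat" where
  "num_blocking n S \<mu> = card {(i, j). i < n \<and> j < n \<and> blocks S \<mu> i j}"

definition expected_blocking :: "nat \<Rightarrow> profile \<Rightarrow> real" where
  "expected_blocking n S =
     measure_pmf.expectation (pmf_of_set (matchings n)) (\<lambda>\<mu>. real (num_blocking n S \<mu>))"

definition min_expected_blocking :: "nat \<Rightarrow> real" where
  "min_expected_blocking n = (INF S\<in>profiles n. expected_blocking n S)"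

definition shell_man_rank :: "nat \<Rightarrow> nat \<Rightarrow> nat \<Rightarrow> nat" where
  "shell_man_rank n g h = nat ((int h - int g) mod int n) + 1"

definition shell_woman_rank :: "nat \<Rightarrow> nat \<Rightarrow> nat \<Rightarrow> nat" where
  "shell_woman_rank n h g = n - nat ((int h - int g) mod int n)"

text \<open>
  \<open>shell_man_rank\<close> and \<open>shell_woman_rank\<close> are the prescribed ranks, and \<open>hollow_shell n\<close> lists partners in
  increasing order of them; \<open>man_rank_hollow_shell\<close> and \<open>woman_rank_hollow_shell\<close> below show that
  they are indeed its ranks.
\<close>

definition hollow_shell :: "nat \<Rightarrow> profile" where
  "hollow_shell n =
     \<lparr> man_pref = (\<lambda>g. {(h, h'). h < n \<and> h' < n \<and> shell_man_rank n g h < shell_man_rank n g h'}),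
       woman_pref = (\<lambda>h. {(g, g'). g < n \<and> g' < n \<and> shell_woman_rank n h g < shell_woman_rank n h g'}) \<rparr>"

lemma strict_pref_order_of_rank:
  assumes "inj_on f {..<n}"
  shows "strict_pref_order n {(x, y). x < n \<and> y < n \<and> f x < (f y :: nat)}"
  using assms unfolding strict_pref_order_def strict_linear_order_on_def
  by (auto simp: trans_def irrefl_def total_on_def inj_on_def not_less intro: le_neq_implies_less)

lemma card_better_of_rank:
  assumes "bij_betw f {..<n} {1..n}" "x < n"
  shows "card {y. y < n \<and> f y < f x} + 1 = (f x :: nat)"
proof -
  have f: "f x \<in> {1..n}" "f ` {..<n} = {1..n}" "inj_on f {..<n}"
    using assms by (auto simp: bij_betw_def)
  have "f ` {y. y < n \<and> f y < f x} = {1..<f x}"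
  proof
    show "f ` {y. y < n \<and> f y < f x} \<subseteq> {1..<f x}" using f(2) by auto
    show "{1..<f x} \<subseteq> f ` {y. y < n \<and> f y < f x}"
    proof
      fix k assume k: "k \<in> {1..<f x}"
      then have "k \<in> f ` {..<n}" using f by auto
      then show "k \<in> f ` {y. y < n \<and> f y < f x}" using k by auto
    qed
  qed
  moreover have "inj_on f {y. y < n \<and> f y < f x}"
    using f(3) by (auto simp: inj_on_def)
  ultimately have "card {y. y < n \<and> f y < f x} = card {1..<f x}"
    by (metis card_image)
  then show ?thesis using f(1) by auto
qed

lemma eq_of_shift_mod_eq:
  fixes a b c n :: int
  assumes "0 \<le> a" "a < n" "0 \<le> b" "b < n" "(a - c) mod n = (b - c) mod n"
  shows "a = b"
proof -
  have "n dvd (a - c) - (b - c)" using assms(5) by (simp add: mod_eq_dvd_iff)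
  then have "n dvd a - b" by simp
  then have "a mod n = b mod n" by (simp add: mod_eq_dvd_iff)
  then show ?thesis using assms by simp
qed

lemma bij_betw_if_inj_into:
  assumes "inj_on f {..<n}" "\<And>x. x < n \<Longrightarrow> f x \<in> {1..(n::nat)}"
  shows "bij_betw f {..<n} {1..n}"
proof -
  have "f ` {..<n} \<subseteq> {1..n}" using assms(2) by auto
  then have "f ` {..<n} = {1..n}" using assms(1) by (intro card_subset_eq) (simp_all add: card_image)
  then show ?thesis using assms(1) by (simp add: bij_betw_def)
qed

lemma bij_shell_man_rank: "bij_betw (shell_man_rank n g) {..<n} {1..n}"
proof (rule bij_betw_if_inj_into)
  show "inj_on (shell_man_rank n g) {..<n}"
  proof (rule inj_onI)
    fix x y assume *: "x \<in> {..<n}" "y \<in> {..<n}" "shell_man_rank n g x = shell_man_rank n g y"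
    then have "(int x - int g) mod int n = (int y - int g) mod int n"
      by (simp add: shell_man_rank_def nat_eq_iff)
    then have "int x = int y" using * by (intro eq_of_shift_mod_eq[of "int x" "int n" "int y" "int g"]) auto
    then show "x = y" by simp
  qed
next
  fix x assume "x < n"
  then have "0 \<le> (int x - int g) mod int n" "(int x - int g) mod int n < int n" by auto
  then show "shell_man_rank n g x \<in> {1..n}" by (auto simp: shell_man_rank_def)
qed

lemma bij_shell_woman_rank: "bij_betw (shell_woman_rank n h) {..<n} {1..n}"
proof (rule bij_betw_if_inj_into)
  have b: "0 \<le> (int h - int x) mod int n \<and> (int h - int x) mod int n < int n" if "x < n" for x
    using that by auto
  show "inj_on (shell_woman_rank n h) {..<n}"
  proof (rule inj_onI)
    fix x y assume *: "x \<in> {..<n}" "y \<in> {..<n}" "shell_woman_rank n h x = shell_woman_rank n h y"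
    then have "(int h - int x) mod int n = (int h - int y) mod int n"
      using b[of x] b[of y] unfolding shell_woman_rank_def lessThan_iff by linarith
    then have "int n dvd (int h - int x) - (int h - int y)" by (simp add: mod_eq_dvd_iff)
    then have "int n dvd int y - int x" by simp
    then have "int y mod int n = int x mod int n" by (simp add: mod_eq_dvd_iff)
    then show "x = y" using * by simp
  qed
  fix x assume "x < n"
  then show "shell_woman_rank n h x \<in> {1..n}" using b[of x] unfolding shell_woman_rank_def atLeastAtMost_iff by linarith
qed

lemma hollow_shell_in_profiles: "hollow_shell n \<in> profiles n"
  using bij_shell_man_rank bij_shell_woman_rank strict_pref_order_of_rank
  by (simp add: profiles_def hollow_shell_def bij_betw_def)

lemma man_rank_hollow_shell:
  assumes "h < n"
  shows "man_rank n (hollow_shell n) g h = nat ((int h - int g) mod int n) + 1"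
  using card_better_of_rank[OF bij_shell_man_rank assms, of g] assms
  by (simp add: man_rank_def hollow_shell_def shell_man_rank_def)

lemma woman_rank_hollow_shell:
  assumes "g < n"
  shows "woman_rank n (hollow_shell n) h g = n - nat ((int h - int g) mod int n)"
  using card_better_of_rank[OF bij_shell_woman_rank assms, of h] assms
  by (simp add: woman_rank_def hollow_shell_def shell_woman_rank_def)

end

theory Submission
  imports Defs "HOL-Real_Asymp.Real_Asymp"
begin

text \<open>
  If man \<open>i\<close> ranks \<open>a\<close> women below \<open>j\<close> and woman \<open>j\<close> ranks \<open>b\<close> men below \<open>i\<close>, the pair \<open>(i, j)\<close> blocks
  a uniformly random matching with probability \<open>a b / (n (n - 1))\<close>. Completing the square,
  \<open>2 a b = (a + b - (n - 1))\<^sup>2 + g a + g b - (n - 1)\<^sup>2\<close> with \<open>g x = 2 (n - 1) x - x\<^sup>2\<close>. Every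
  preference list realises each of the values \<open>0, \<dots>, n - 1\<close> once, so summing \<open>g\<close> gives the same total
  for all profiles, and only the squares depend on the profile. They all vanish for the cyclic
  Hollow-Shell.
\<close>

section \<open>Ranks counted from the bottom\<close>

definition num_worse :: "nat \<Rightarrow> nat rel \<Rightarrow> nat \<Rightarrow> nat" where
  "num_worse n r x = card {y. y < n \<and> (x, y) \<in> r}"

text \<open>Transitivity and irreflexivity make the count drop strictly along \<open>r\<close>, and
  totality turns this into injectivity; \<open>n\<close> distinct values below \<open>n\<close>
  exhaust \<open>{..<n}\<close>.\<close>

lemma bij_betw_num_worse:
  assumes "strict_pref_order n r"
  shows "bij_betw (num_worse n r) {..<n} {..<n}"
proof -
  have tr: "trans r" and ir: "irrefl r" and tot: "total_on {..<n} r" and sub: "r \<subseteq> {..<n} \<times> {..<n}"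
    using assms by (auto simp: strict_pref_order_def strict_linear_order_on_def)
  have less: "num_worse n r y < num_worse n r x" if "(x, y) \<in> r" for x y
    unfolding num_worse_def
  proof (rule psubset_card_mono)
    show "{z. z < n \<and> (y, z) \<in> r} \<subset> {z. z < n \<and> (x, z) \<in> r}"
      using that tr ir sub by (auto simp: irrefl_def dest: transD)
  qed simp
  have inj: "inj_on (num_worse n r) {..<n}"
    by (rule inj_onI) (metis less less_irrefl tot total_on_def)
  have "num_worse n r x < n" if "x < n" for x
  proof -
    have "num_worse n r x < card {..<n}"
      unfolding num_worse_def using that ir by (intro psubset_card_mono) (auto simp: irrefl_def)
    then show ?thesis by simp
  qed
  then have "num_worse n r ` {..<n} \<subseteq> {..<n}" by auto
  then have "num_worse n r ` {..<n} = {..<n}"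
    using inj by (intro card_subset_eq) (simp_all add: card_image)
  then show ?thesis using inj by (simp add: bij_betw_def)
qed

lemma num_worse_of_rank:
  assumes "bij_betw f {..<n} {1..n}" "x < n"
  shows "num_worse n {(x, y). x < n \<and> y < n \<and> f x < f y} x = n - f x"
proof -
  have "bij_betw f {y. y < n \<and> f x < f y} {f x<..n}"
  proof (rule bij_betw_subset[OF assms(1)])
    show "f ` {y. y < n \<and> f x < f y} = {f x<..n}"
    proof
      show "f ` {y. y < n \<and> f x < f y} \<subseteq> {f x<..n}"
        using assms(1) by (auto simp: bij_betw_def)
      show "{f x<..n} \<subseteq> f ` {y. y < n \<and> f x < f y}"
      proof
        fix k assume k: "k \<in> {f x<..n}"
        then have "k \<in> f ` {..<n}" using assms(1) by (auto simp: bij_betw_def)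
        then show "k \<in> f ` {y. y < n \<and> f x < f y}" using k by auto
      qed
    qed
  qed auto
  then have "card {y. y < n \<and> f x < f y} = n - f x" by (simp add: bij_betw_same_card)
  then show ?thesis using assms(2) by (simp add: num_worse_def)
qed

section \<open>Permutations with prescribed values\<close>

text \<open>Composing with \<open>inv \<tau>\<close> turns agreement with \<open>\<tau>\<close> on
  \<open>B\<close> into fixing \<open>B\<close> pointwise, which leaves exactly the permutations of
  \<open>A - B\<close>.\<close>

lemma card_permutes_agreeing_on:
  assumes "finite A" "B \<subseteq> A" "\<tau> permutes A"
  shows "card {\<mu>. \<mu> permutes A \<and> (\<forall>x\<in>B. \<mu> x = \<tau> x)} = fact (card A - card B)"
proof -
  have "{\<mu>. \<mu> permutes A \<and> (\<forall>x\<in>B. \<mu> x = \<tau> x)} = (\<lambda>p. \<tau> \<circ> p) ` {p. p permutes A - B}"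
  proof (intro equalityI subsetI)
    fix \<mu> assume \<mu>: "\<mu> \<in> {\<mu>. \<mu> permutes A \<and> (\<forall>x\<in>B. \<mu> x = \<tau> x)}"
    have "inv \<tau> \<circ> \<mu> permutes A"
      using \<mu> assms(3) by (auto intro: permutes_compose permutes_inv)
    moreover have "(inv \<tau> \<circ> \<mu>) x = x" if "x \<in> B" for x
      using \<mu> that permutes_inverses[OF assms(3)] by simp
    ultimately have "inv \<tau> \<circ> \<mu> permutes A - B"
      by (rule permutes_superset) blast
    moreover have "\<mu> = \<tau> \<circ> (inv \<tau> \<circ> \<mu>)"
      using permutes_inverses[OF assms(3)] by (simp add: fun_eq_iff)
    ultimately show "\<mu> \<in> (\<lambda>p. \<tau> \<circ> p) ` {p. p permutes A - B}" by blast
  next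
    fix \<mu> assume "\<mu> \<in> (\<lambda>p. \<tau> \<circ> p) ` {p. p permutes A - B}"
    then obtain p where p: "p permutes A - B" "\<mu> = \<tau> \<circ> p" by blast
    then show "\<mu> \<in> {\<mu>. \<mu> permutes A \<and> (\<forall>x\<in>B. \<mu> x = \<tau> x)}"
      using assms(3) permutes_subset[OF p(1), of A]
      by (auto intro: permutes_compose simp: permutes_not_in)
  qed
  moreover have "inj_on (\<lambda>p. \<tau> \<circ> p) {p. p permutes A - B}"
    using permutes_inj[OF assms(3)] by (auto simp: inj_on_def fun_eq_iff)
  moreover have "card (A - B) = card A - card B"
    using assms by (meson card_Diff_subset finite_subset)
  ultimately show ?thesis
    using assms(1) by (simp add: card_image card_permutations[OF refl])
qed

lemma card_permutes_two_values:
  assumes "finite A" "i \<in> A" "l \<in> A" "j \<in> A" "k \<in> A" "i \<noteq> l" "k \<noteq> j"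
  shows "card {\<mu>. \<mu> permutes A \<and> \<mu> i = k \<and> \<mu> l = j} = fact (card A - 2)"
proof -
  \<comment> \<open>The inner swap sends \<open>l\<close> to the point that the outer one carries to
    \<open>j\<close>. It fixes \<open>i\<close>, because \<open>i \<noteq> l\<close> and
    \<open>k \<noteq> j\<close> keep both swapped points away from \<open>i\<close>; the outer one
    then sends \<open>i\<close> to \<open>k\<close>.\<close>
  define \<tau> where "\<tau> = Transposition.transpose i k \<circ> Transposition.transpose l (Transposition.transpose i k j)"
  have "\<tau> permutes A"
    unfolding \<tau>_def using assms
    by (intro permutes_compose permutes_swap_id) (auto simp: Transposition.transpose_def)
  moreover have "\<tau> i = k" "\<tau> l = j"
    using assms by (auto simp: \<tau>_def Transposition.transpose_def)
  ultimately show ?thesis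
    using card_permutes_agreeing_on[of A "{i, l}" \<tau>] assms by (simp add: numeral_2_eq_2)
qed

section \<open>Blocking probabilities and the expectation\<close>

text \<open>The pair blocks exactly when \<open>i\<close> is matched to some \<open>k\<close> he
  ranks below \<open>j\<close> and \<open>j\<close> to some \<open>l\<close> she ranks below
  \<open>i\<close>. Each such choice of \<open>(k, l)\<close> leaves \<open>n - 2\<close> men to be
  matched freely.\<close>

lemma card_blocking_matchings:
  assumes S: "S \<in> profiles n" and ij: "i < n" "j < n"
  shows "card {\<mu> \<in> matchings n. blocks S \<mu> i j} =
           num_worse n (man_pref S i) j * num_worse n (woman_pref S j) i * fact (n - 2)"
proof -
  define K where "K = {k. k < n \<and> (j, k) \<in> man_pref S i}"
  define L where "L = {l. l < n \<and> (i, l) \<in> woman_pref S j}"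
  define M where "M = (\<lambda>(k, l). {\<mu>. \<mu> permutes {..<n} \<and> \<mu> i = k \<and> \<mu> l = j})"
  have ir: "irrefl (man_pref S i)" "irrefl (woman_pref S j)"
    using S ij by (auto simp: profiles_def strict_pref_order_def strict_linear_order_on_def)
  have "{\<mu> \<in> matchings n. blocks S \<mu> i j} = (\<Union>p\<in>K \<times> L. M p)"
  proof (intro equalityI subsetI)
    fix \<mu> assume \<mu>: "\<mu> \<in> {\<mu> \<in> matchings n. blocks S \<mu> i j}"
    then have p: "\<mu> permutes {..<n}" by (simp add: matchings_def)
    have "\<mu> i < n" "inv \<mu> j < n" "\<mu> (inv \<mu> j) = j"
      using ij permutes_in_image[OF p] permutes_in_image[OF permutes_inv[OF p]]
        permutes_inverses[OF p] by auto
    then have "(\<mu> i, inv \<mu> j) \<in> K \<times> L" "\<mu> \<in> M (\<mu> i, inv \<mu> j)"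
      using \<mu> p by (auto simp: K_def L_def M_def blocks_def)
    then show "\<mu> \<in> (\<Union>p\<in>K \<times> L. M p)" by blast
  next
    fix \<mu> assume "\<mu> \<in> (\<Union>p\<in>K \<times> L. M p)"
    then obtain k l where *: "k \<in> K" "l \<in> L" "\<mu> permutes {..<n}" "\<mu> i = k" "\<mu> l = j"
      by (auto simp: M_def)
    then have "inv \<mu> j = l" by (metis permutes_inverses(2))
    then show "\<mu> \<in> {\<mu> \<in> matchings n. blocks S \<mu> i j}"
      using * by (auto simp: matchings_def blocks_def K_def L_def)
  qed
  moreover have "card (\<Union>p\<in>K \<times> L. M p) = (\<Sum>p\<in>K \<times> L. card (M p))"
  proof (rule card_UN_disjoint)
    show "finite (K \<times> L)" by (simp add: K_def L_def)
    have "M p \<subseteq> {\<mu>. \<mu> permutes {..<n}}" for p by (auto simp: M_def split: prod.splits)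
    then show "\<forall>p\<in>K \<times> L. finite (M p)"
      using finite_permutations finite_subset by blast
    \<comment> \<open>A matching determines both the partner of \<open>i\<close> and the partner of
      \<open>j\<close>.\<close>
    show "\<forall>p\<in>K \<times> L. \<forall>q\<in>K \<times> L. p \<noteq> q \<longrightarrow> M p \<inter> M q = {}"
      by (auto simp: M_def) (metis permutes_inverses(2))
  qed
  \<comment> \<open>Irreflexivity gives \<open>k \<noteq> j\<close> and \<open>l \<noteq> i\<close>,
    so the two prescribed values are compatible.\<close>
  moreover have "card (M p) = fact (n - 2)" if "p \<in> K \<times> L" for p
  proof -
    obtain k l where "p = (k, l)" by fastforce
    then show ?thesis
      using that ij ir card_permutes_two_values[of "{..<n}" i l j k]
      by (auto simp: M_def K_def L_def irrefl_def)
  qed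
  ultimately show ?thesis
    by (simp add: card_cartesian_product num_worse_def K_def L_def)
qed

text \<open>Linearity of expectation: summing over pairs first reduces the claim to
  \<open>card_blocking_matchings\<close> divided by \<open>n!\<close>.\<close>

lemma expected_blocking_eq_sum:
  assumes n: "n \<ge> 2" and S: "S \<in> profiles n"
  shows "expected_blocking n S =
    (\<Sum>i<n. \<Sum>j<n. real (num_worse n (man_pref S i) j) * real (num_worse n (woman_pref S j) i))
      / (real n * (real n - 1))"
proof -
  have fin: "finite (matchings n)" and card: "card (matchings n) = fact n"
    by (simp_all add: matchings_def finite_permutations card_permutations)
  have ne: "matchings n \<noteq> {}" using card by force
  have fact: "(fact n :: real) = real n * (real n - 1) * fact (n - 2)"
    using n by (cases n; cases "n - 1") (auto simp: algebra_simps)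
  have num: "real (num_blocking n S \<mu>) = (\<Sum>i<n. \<Sum>j<n. of_bool (blocks S \<mu> i j))" for \<mu>
  proof -
    have "{(i, j). i < n \<and> j < n \<and> blocks S \<mu> i j} = (SIGMA i:{..<n}. {j\<in>{..<n}. blocks S \<mu> i j})"
      by auto
    then show ?thesis
      by (simp add: num_blocking_def of_bool_def sum.If_cases Int_def)
  qed
  have "expected_blocking n S = (\<Sum>\<mu>\<in>matchings n. real (num_blocking n S \<mu>)) / fact n"
    by (simp add: expected_blocking_def integral_pmf_of_set[OF ne fin] card)
  also have "(\<Sum>\<mu>\<in>matchings n. real (num_blocking n S \<mu>)) =
      (\<Sum>i<n. \<Sum>j<n. \<Sum>\<mu>\<in>matchings n. of_bool (blocks S \<mu> i j))"
    unfolding num by (subst sum.swap, rule sum.cong[OF refl], rule sum.swap)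
  also have "\<dots> = (\<Sum>i<n. \<Sum>j<n. real (card {\<mu> \<in> matchings n. blocks S \<mu> i j}))"
    using fin by (simp add: of_bool_def sum.If_cases Int_def)
  also have "\<dots> = (\<Sum>i<n. \<Sum>j<n.
      real (num_worse n (man_pref S i) j) * real (num_worse n (woman_pref S j) i) * fact (n - 2))"
    by (intro sum.cong refl) (simp add: card_blocking_matchings[OF S])
  finally show ?thesis
    by (simp add: fact flip: sum_distrib_right)
qed

section \<open>Completing the square\<close>

text \<open>The total of \<open>g\<close> over one preference list, the same for every agent in
  every profile.\<close>

lemma sum_completing_square_term:
  "(\<Sum>k<n. 2 * (real n - 1) * real k - (real k)\<^sup>2) = real n * (real n - 1) * (4 * real n - 5) / 6"
proof -
  have s1: "(\<Sum>k<n. real k) = real n * (real n - 1) / 2"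
    by (induction n) (auto simp: field_simps)
  have s2: "(\<Sum>k<n. (real k)\<^sup>2) = real n * (real n - 1) * (2 * real n - 1) / 6"
    by (induction n) (auto simp: field_simps power2_eq_square)
  show ?thesis
    unfolding sum_subtractf sum_distrib_left[symmetric] s1 s2 by (simp add: field_simps)
qed

text \<open>The first term is common to all profiles. The second is a nonnegative defect, zero
  exactly when the two mutual ranks of every pair add up to \<open>n + 1\<close>.\<close>

lemma expected_blocking_eq:
  assumes n: "n \<ge> 2" and S: "S \<in> profiles n"
  shows "expected_blocking n S = real n * (real n - 2) / 6 +
    (\<Sum>i<n. \<Sum>j<n. (real (num_worse n (man_pref S i) j) + real (num_worse n (woman_pref S j) i)
       - (real n - 1))\<^sup>2) / (2 * real n * (real n - 1))"
proof -
  define a where "a i j = real (num_worse n (man_pref S i) j)" for i j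
  define b where "b i j = real (num_worse n (woman_pref S j) i)" for i j
  define c where "c = real n - 1"
  define g where "g x = 2 * c * x - x\<^sup>2" for x
  define G where "G = (\<Sum>k<n. g (real k))"
  define Q where "Q = (\<Sum>i<n. \<Sum>j<n. (a i j + b i j - c)\<^sup>2)"
  have ga: "(\<Sum>j<n. g (a i j)) = G" if "i < n" for i
    unfolding a_def G_def using S that
    by (intro sum.reindex_bij_betw[where g = "\<lambda>k. g (real k)"] bij_betw_num_worse)
      (auto simp: profiles_def)
  have gb: "(\<Sum>i<n. g (b i j)) = G" if "j < n" for j
    unfolding b_def G_def using S that
    by (intro sum.reindex_bij_betw[where g = "\<lambda>k. g (real k)"] bij_betw_num_worse)
      (auto simp: profiles_def)
  have "2 * (\<Sum>i<n. \<Sum>j<n. a i j * b i j) =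
      (\<Sum>i<n. \<Sum>j<n. (a i j + b i j - c)\<^sup>2 + g (a i j) + g (b i j) - c\<^sup>2)"
    by (simp add: sum_distrib_left g_def power2_eq_square algebra_simps)
  also have "\<dots> = Q + (\<Sum>i<n. \<Sum>j<n. g (a i j)) + (\<Sum>i<n. \<Sum>j<n. g (b i j)) - (real n)\<^sup>2 * c\<^sup>2"
    by (simp add: sum.distrib sum_subtractf Q_def power2_eq_square)
  \<comment> \<open>The values \<open>b i j\<close> run through a full list only for a fixed woman
    \<open>j\<close>, so the men must be summed first.\<close>
  also have "(\<Sum>i<n. \<Sum>j<n. g (b i j)) = (\<Sum>j<n. \<Sum>i<n. g (b i j))"
    by (rule sum.swap)
  finally have "2 * (\<Sum>i<n. \<Sum>j<n. a i j * b i j) = Q + 2 * real n * G - (real n)\<^sup>2 * c\<^sup>2"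
    by (simp add: ga gb)
  \<comment> \<open>With \<open>G = n (n - 1) (4 n - 5) / 6\<close>, both sides equal
    \<open>n^2 (n - 1) (n - 2) / 3\<close>.\<close>
  moreover have "2 * real n * G - (real n)\<^sup>2 * c\<^sup>2 =
      2 * (real n * (real n - 1) * (real n * (real n - 2) / 6))"
    unfolding G_def g_def c_def sum_completing_square_term
    by (simp add: power2_eq_square field_simps)
  ultimately have *: "(\<Sum>i<n. \<Sum>j<n. a i j * b i j) =
      Q / 2 + real n * (real n - 1) * (real n * (real n - 2) / 6)"
    by linarith
  have "expected_blocking n S = (\<Sum>i<n. \<Sum>j<n. a i j * b i j) / (real n * (real n - 1))"
    using expected_blocking_eq_sum[OF n S] by (simp add: a_def b_def)
  also have "\<dots> = real n * (real n - 2) / 6 + Q / (2 * real n * (real n - 1))"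
    unfolding * using n by (simp add: add_divide_distrib)
  finally show ?thesis by (simp add: Q_def a_def b_def c_def)
qed

section \<open>The minimum and its asymptotics\<close>

text \<open>For \<open>d = (j - i) mod n\<close>, the man's rank \<open>d + 1\<close> leaves
  \<open>n - 1 - d\<close> women below \<open>j\<close>, and the woman's rank \<open>n - d\<close>
  leaves \<open>d\<close> men below \<open>i\<close>. These add up to \<open>n - 1\<close>, so every
  square vanishes.\<close>

lemma expected_blocking_hollow_shell:
  assumes n: "n \<ge> 2"
  shows "expected_blocking n (hollow_shell n) = real n * (real n - 2) / 6"
proof -
  have "real (num_worse n (man_pref (hollow_shell n) i) j)
      + real (num_worse n (woman_pref (hollow_shell n) j) i) - (real n - 1) = 0"
    if "i < n" "j < n" for i j
  proof -
    \<comment> \<open>The bound makes the truncated subtractions \<open>n - (d + 1)\<close> and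
      \<open>n - (n - d)\<close> exact.\<close>
    have "nat ((int j - int i) mod int n) < n" using n by (simp add: nat_less_iff)
    then show ?thesis
      using num_worse_of_rank[OF bij_shell_man_rank that(2), of i]
        num_worse_of_rank[OF bij_shell_woman_rank that(1), of j]
      by (simp add: hollow_shell_def shell_man_rank_def shell_woman_rank_def)
  qed
  then show ?thesis
    unfolding expected_blocking_eq[OF n hollow_shell_in_profiles] by (simp cong: sum.cong_simp)
qed

lemma expected_blocking_ge:
  assumes "n \<ge> 2" "S \<in> profiles n"
  shows "real n * (real n - 2) / 6 \<le> expected_blocking n S"
  unfolding expected_blocking_eq[OF assms] using assms(1) by (simp add: sum_nonneg)

lemma min_expected_blocking_eq:
  assumes "n \<ge> 2"
  shows "min_expected_blocking n = real n * (real n - 2) / 6"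
  unfolding min_expected_blocking_def
proof (rule cInf_eq_minimum)
  show "real n * (real n - 2) / 6 \<in> expected_blocking n ` profiles n"
    using expected_blocking_hollow_shell[OF assms] hollow_shell_in_profiles by (metis imageI)
qed (use expected_blocking_ge[OF assms] in auto)

theorem mainTheorem3:
  shows "(\<forall>n\<ge>2.
            hollow_shell n \<in> profiles n \<and>
            (\<forall>S\<in>profiles n. expected_blocking n (hollow_shell n) \<le> expected_blocking n S) \<and>
            min_expected_blocking n = expected_blocking n (hollow_shell n) \<and>
            expected_blocking n (hollow_shell n) = real n * (real n - 2) / 6) \<and>
         min_expected_blocking \<sim>[at_top] (\<lambda>n. (real n)\<^sup>2 / 6) \<and>
         (\<lambda>n. real_of_int \<lfloor>(real n - 1)\<^sup>2 / 4\<rfloor>) \<sim>[at_top] (\<lambda>n. (real n)\<^sup>2 / 4)"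
proof (intro conjI)
  \<comment> \<open>The closed form is available from \<open>n = 2\<close> on, which suffices for an
    asymptotic statement.\<close>
  have "eventually (\<lambda>n. min_expected_blocking n = real n * (real n - 2) / 6) at_top"
    using min_expected_blocking_eq by (auto simp: eventually_at_top_linorder)
  moreover have "(\<lambda>n. real n * (real n - 2) / 6) \<sim>[at_top] (\<lambda>n. (real n)\<^sup>2 / 6)"
    by real_asymp
  ultimately show "min_expected_blocking \<sim>[at_top] (\<lambda>n. (real n)\<^sup>2 / 6)"
    by (subst asymp_equiv_cong) auto
  show "(\<lambda>n. real_of_int \<lfloor>(real n - 1)\<^sup>2 / 4\<rfloor>) \<sim>[at_top] (\<lambda>n. (real n)\<^sup>2 / 4)"
    by real_asymp
qed (metis hollow_shell_in_profiles expected_blocking_hollow_shell expected_blocking_ge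
      min_expected_blocking_eq)

end
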